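(* Let $\tau$ be a compact topology on a set $X$. Then there is a compact topology $\tau'$ on $X$ with $\tau\subseteq\tau'$ such that $(X,\tau')$ is a $US$-space.
   Context: Compactness means that every open cover has a finite subcover; no separation axiom is included. A topological space is called a $US$-space if each convergent sequence has a unique limit. *)

theory Defs
  imports "HOL-Analysis.Analysis"
begin

definition US_space :: "'a topology \<Rightarrow> bool" where
  "US_space T \<longleftrightarrow>
     (\<forall>s :: nat \<Rightarrow> 'a. \<forall>l l'. range s \<subseteq> topspace T \<longrightarrow>
        limitin T s l sequentially \<longrightarrow> limitin T s l' sequentially \<longrightarrow> l = l')"

end

theory Submission imports Defs begin

text \<open>
  Non-uniqueness of limits is destroyed by declaring enough convergent sequences closed, and the
  point is to do this for so few of them that compactness survives. It is convenient to forget the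
  enumeration of a sequence and to say that an infinite set \<open>A\<close> converges to \<open>x\<close> if each
  neighbourhood of \<open>x\<close> contains all but finitely many points of \<open>A\<close>.

  Choose, by Zorn's lemma, a maximal family \<open>M\<close> of pairs \<open>(A, x)\<close> of this kind in which the sets of
  any two distinct pairs have finite intersection, and refine \<open>\<tau>\<close> by making closed all finite sets
  and all sets \<open>B \<union> {x}\<close> with \<open>B \<subseteq> A\<close> and \<open>(A, x) \<in> M\<close>.

  The refinement is compact (\<open>compact_space_refinement\<close>). By Alexander's subbase theorem it suffices
  to look at covers by subbasic sets. If one of these is the complement of some \<open>B \<union> {x}\<close>, then
  any member of the cover that contains \<open>x\<close> contains all but finitely many points of \<open>B \<union> {x}\<close>;
  for the complement of another \<open>B' \<union> {x'}\<close> this is what almost disjointness says.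

  The refinement is a US-space (\<open>US_space_refinement\<close>). A sequence with two limits takes every value
  only finitely often, so that its range is an infinite set converging in \<open>\<tau>\<close>. By
  maximality the range has infinite intersection \<open>B\<close> with some \<open>A\<close>, where \<open>(A, x) \<in> M\<close>. A
  limit \<open>m \<noteq> x\<close> would then lie in the open complement of \<open>(B - {m}) \<union> {x}\<close>, which
  misses infinitely many terms of the sequence. Hence both limits are \<open>x\<close>.
\<close>

section \<open>Infinite sets converging to a point\<close>

definition set_converges_to :: "'a topology \<Rightarrow> 'a set \<Rightarrow> 'a \<Rightarrow> bool" where
  "set_converges_to T A x \<longleftrightarrow> infinite A \<and> x \<in> topspace T \<and>
     (\<forall>U. openin T U \<and> x \<in> U \<longrightarrow> finite (A - U))"

definition almost_disjoint :: "('a set \<times> 'a) set \<Rightarrow> bool" where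
  "almost_disjoint M \<longleftrightarrow> pairwise (\<lambda>p q. finite (fst p \<inter> fst q)) M"

lemma almost_disjointD:
  assumes "almost_disjoint M" "(A, x) \<in> M" "(A', x') \<in> M" "(A, x) \<noteq> (A', x')"
  shows "finite (A \<inter> A')"
  using assms by (fastforce simp: almost_disjoint_def pairwise_def)

lemma set_converges_to_range:
  assumes "limitin T s l sequentially" "infinite (range s)"
  shows "set_converges_to T (range s) l"
proof -
  have "finite (range s - U)" if "openin T U" "l \<in> U" for U
  proof -
    have "eventually (\<lambda>n. s n \<in> U) sequentially"
      using assms(1) that by (auto simp: limitin_def)
    then obtain N where "\<And>n. n \<ge> N \<Longrightarrow> s n \<in> U"
      by (auto simp: eventually_sequentially)
    then have "range s - U \<subseteq> s ` {..<N}"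
      by (auto intro!: imageI) (metis leI)
    then show ?thesis
      by (rule finite_subset) simp
  qed
  then show ?thesis
    using assms by (auto simp: set_converges_to_def limitin_def)
qed

text \<open>A convergent set \<open>C\<close> that meets every member of a maximal family in a finite set could be
  added to the family.\<close>

lemma maximal_almost_disjoint_family:
  obtains M where "\<And>A x. (A, x) \<in> M \<Longrightarrow> set_converges_to T A x"
    and "almost_disjoint M"
    and "\<And>C y. set_converges_to T C y \<Longrightarrow> \<exists>(A, x) \<in> M. infinite (A \<inter> C)"
proof -
  define \<M> where
    "\<M> = {M. (\<forall>(A, x) \<in> M. set_converges_to T A x) \<and> almost_disjoint M}"
  have "\<exists>M\<in>\<M>. \<forall>N\<in>\<M>. M \<subseteq> N \<longrightarrow> N = M"
  proof (rule subset_Zorn')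
    fix \<C> assume "subset.chain \<M> \<C>"
    then have "\<C> \<subseteq> \<M>" and "chain\<^sub>\<subseteq> \<C>"
      by (auto simp: subset_chain_def chain_subset_def)
    then have "almost_disjoint (\<Union>\<C>)"
      unfolding almost_disjoint_def
      by (intro pairwise_chain_Union) (auto simp: \<M>_def almost_disjoint_def)
    moreover have "\<forall>p \<in> N. case p of (A, x) \<Rightarrow> set_converges_to T A x" if "N \<in> \<C>" for N
      using that \<open>\<C> \<subseteq> \<M>\<close> by (auto simp: \<M>_def)
    ultimately show "\<Union>\<C> \<in> \<M>"
      unfolding \<M>_def by blast
  qed
  then obtain M where M: "M \<in> \<M>" and max: "\<And>N. N \<in> \<M> \<Longrightarrow> M \<subseteq> N \<Longrightarrow> N = M"
    by blast
  have "\<exists>(A, x) \<in> M. infinite (A \<inter> C)" if C: "set_converges_to T C y" for C y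
  proof (rule ccontr)
    assume "\<not> ?thesis"
    then have fin: "finite (A \<inter> C)" if "(A, x) \<in> M" for A x
      using that by blast
    have "insert (C, y) M \<in> \<M>"
      using M C fin by (auto simp: \<M>_def almost_disjoint_def pairwise_insert Int_commute)
    then have "(C, y) \<in> M"
      using max by blast
    then have "finite (C \<inter> C)"
      by (rule fin)
    then show False
      using C by (simp add: set_converges_to_def)
  qed
  moreover have "set_converges_to T A x" if "(A, x) \<in> M" for A x
    using M that by (auto simp: \<M>_def)
  moreover have "almost_disjoint M"
    using M by (simp add: \<M>_def)
  ultimately show ?thesis
    using that by blast
qed

section \<open>Making the chosen sets closed\<close>

definition refinement_subbase :: "'a topology \<Rightarrow> ('a set \<times> 'a) set \<Rightarrow> 'a set set" where
  "refinement_subbase T M = {U. openin T U} \<union> {topspace T - F |F. finite F} \<union>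
     {topspace T - insert x B |x B. \<exists>A. (A, x) \<in> M \<and> B \<subseteq> A}"

definition refinement :: "'a topology \<Rightarrow> ('a set \<times> 'a) set \<Rightarrow> 'a topology" where
  "refinement T M = topology_generated_by (refinement_subbase T M)"

lemma refinement_subbase_cases:
  assumes "V \<in> refinement_subbase T M"
  obtains "openin T V" | F where "finite F" "V = topspace T - F"
    | A x B where "(A, x) \<in> M" "B \<subseteq> A" "V = topspace T - insert x B"
  using assms by (auto simp: refinement_subbase_def)

lemma Union_refinement_subbase: "\<Union>(refinement_subbase T M) = topspace T"
  by (auto simp: refinement_subbase_def dest: openin_subset)

lemma topspace_refinement [simp]: "topspace (refinement T M) = topspace T"
  by (simp add: refinement_def Union_refinement_subbase)

lemma openin_refinement_subbase:
  "U \<in> refinement_subbase T M \<Longrightarrow> openin (refinement T M) U"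
  by (simp add: refinement_def topology_generated_by_Basis)

lemma openin_refinement: "openin T U \<Longrightarrow> openin (refinement T M) U"
  by (rule openin_refinement_subbase) (simp add: refinement_subbase_def)

lemma openin_refinement_cofinite:
  "finite F \<Longrightarrow> openin (refinement T M) (topspace T - F)"
  by (rule openin_refinement_subbase) (auto simp: refinement_subbase_def)

lemma openin_refinement_Diff_insert:
  "(A, x) \<in> M \<Longrightarrow> B \<subseteq> A \<Longrightarrow> openin (refinement T M) (topspace T - insert x B)"
  by (rule openin_refinement_subbase) (auto simp: refinement_subbase_def)

text \<open>This is where almost disjointness enters: a subbasic neighbourhood of \<open>x\<close> that comes from
  another pair of \<open>M\<close> misses only finitely many points of \<open>A\<close>, and one that comes from the pair
  \<open>(A, x)\<close> itself would not contain \<open>x\<close>.\<close>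

lemma finite_Diff_refinement_subbase:
  assumes conv: "set_converges_to T A x" and ad: "almost_disjoint M" and Ax: "(A, x) \<in> M"
    and V: "V \<in> refinement_subbase T M" "x \<in> V"
  shows "finite (A \<inter> topspace T - V)"
proof -
  consider "openin T V" | F where "finite F" "V = topspace T - F"
    | A' x' B' where "(A', x') \<in> M" "B' \<subseteq> A'" "V = topspace T - insert x' B'"
    using V(1) by (rule refinement_subbase_cases)
  then show ?thesis
  proof cases
    case 1
    then have "finite (A - V)"
      using conv V(2) by (auto simp: set_converges_to_def)
    then show ?thesis
      by (rule rev_finite_subset) auto
  next
    case 2
    then show ?thesis
      by (auto intro: finite_subset[of _ F])
  next
    case 3
    then have "(A, x) \<noteq> (A', x')"
      using V(2) by auto
    then have "finite (insert x' (A \<inter> A'))"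
      using almost_disjointD[OF ad Ax 3(1)] by simp
    then show ?thesis
      by (rule rev_finite_subset) (use 3 in auto)
  qed
qed

text \<open>Alexander's theorem is about the subbase topology in which the empty intersection is the
  whole space. That topology contains every set of \<open>\<B>\<close>, hence is at least as fine as the
  topology generated by \<open>\<B>\<close>, and compactness passes to coarser topologies.\<close>

lemma compact_space_topology_generated_by:
  assumes "\<And>\<C>. \<C> \<subseteq> \<B> \<Longrightarrow> \<Union>\<C> = \<Union>\<B> \<Longrightarrow> \<exists>\<C>'. finite \<C>' \<and> \<C>' \<subseteq> \<C> \<and> \<Union>\<C>' = \<Union>\<B>"
  shows "compact_space (topology_generated_by \<B>)"
proof -
  define Y where
    "Y = topology (arbitrary union_of (finite intersection_of (\<lambda>U. U \<in> \<B>) relative_to \<Union>\<B>))"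
  have topspace_Y: "topspace Y = \<Union>\<B>"
    by (simp add: Y_def)
  have "compact_space Y"
    using Y_def[symmetric] by (rule Alexander_subbase) (use assms topspace_Y in auto)
  have "openin Y U" if "U \<in> \<B>" for U
  proof -
    have "(finite intersection_of (\<lambda>U. U \<in> \<B>) relative_to \<Union>\<B>) (\<Union>\<B> \<inter> U)"
      using that by (intro relative_to_inc finite_intersection_of_inc)
    moreover have "\<Union>\<B> \<inter> U = U"
      using that by blast
    ultimately show ?thesis
      by (simp add: Y_def openin_subbase arbitrary_union_of_inc)
  qed
  then have "openin Y U" if "openin (topology_generated_by \<B>) U" for U
    using generate_topology_on_coarsest[OF istopology_openin _ openin_topology_generated_by[OF that]]
    by blast
  then show ?thesis
    using \<open>compact_space Y\<close> by (simp add: compact_space_alt topspace_Y)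
qed

lemma finite_subcover_if_almost_covers:
  assumes "finite \<D>" "\<D> \<subseteq> \<C>" "finite (\<Union>\<C> - \<Union>\<D>)"
  shows "\<exists>\<C>'. finite \<C>' \<and> \<C>' \<subseteq> \<C> \<and> \<Union>\<C>' = \<Union>\<C>"
proof -
  have "\<forall>z \<in> \<Union>\<C> - \<Union>\<D>. \<exists>V \<in> \<C>. z \<in> V"
    by blast
  then obtain f where f: "\<And>z. z \<in> \<Union>\<C> - \<Union>\<D> \<Longrightarrow> f z \<in> \<C> \<and> z \<in> f z"
    by metis
  have "\<Union>(\<D> \<union> f ` (\<Union>\<C> - \<Union>\<D>)) = \<Union>\<C>"
    using assms(2) f by blast
  moreover have "finite (\<D> \<union> f ` (\<Union>\<C> - \<Union>\<D>))" "\<D> \<union> f ` (\<Union>\<C> - \<Union>\<D>) \<subseteq> \<C>"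
    using assms f by auto
  ultimately show ?thesis
    by blast
qed

text \<open>If the cover contains a subbasic set that is not open in \<open>T\<close>, then one or two of its members
  already miss only finitely many points; otherwise compactness of \<open>T\<close> applies.\<close>

lemma compact_space_refinement:
  assumes compact: "compact_space T" and ad: "almost_disjoint M"
    and conv: "\<And>A x. (A, x) \<in> M \<Longrightarrow> set_converges_to T A x"
  shows "compact_space (refinement T M)"
  unfolding refinement_def
proof (rule compact_space_topology_generated_by)
  fix \<C> assume sub: "\<C> \<subseteq> refinement_subbase T M"
    and cover: "\<Union>\<C> = \<Union>(refinement_subbase T M)"
  have cover': "\<Union>\<C> = topspace T"
    by (simp add: cover Union_refinement_subbase)
  consider "\<C> \<subseteq> {U. openin T U}" | F where "finite F" "topspace T - F \<in> \<C>"
    | A x B where "(A, x) \<in> M" "B \<subseteq> A" "topspace T - insert x B \<in> \<C>"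
  proof (cases "\<C> \<subseteq> {U. openin T U}")
    case False
    then obtain V where V: "V \<in> \<C>" "\<not> openin T V"
      by blast
    then have "V \<in> refinement_subbase T M"
      using sub by blast
    then show ?thesis
      by (cases rule: refinement_subbase_cases) (use V that in auto)
  qed
  then have "\<exists>\<C>'. finite \<C>' \<and> \<C>' \<subseteq> \<C> \<and> \<Union>\<C>' = \<Union>\<C>"
  proof cases
    case 1
    then obtain \<D> where "finite \<D>" "\<D> \<subseteq> \<C>" "topspace T \<subseteq> \<Union>\<D>"
      using compact cover' unfolding compact_space_alt by (metis mem_Collect_eq order_refl subsetD)
    then have "\<Union>\<D> = \<Union>\<C>"
      using cover' by blast
    then show ?thesis
      using \<open>finite \<D>\<close> \<open>\<D> \<subseteq> \<C>\<close> by blast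
  next
    case 2
    have "\<Union>\<C> - \<Union>{topspace T - F} \<subseteq> F"
      using cover' by auto
    then show ?thesis
      using 2 by (intro finite_subcover_if_almost_covers[of "{topspace T - F}"])
        (auto intro: finite_subset)
  next
    case 3
    then have x: "x \<in> \<Union>\<C>"
      using conv cover' by (auto simp: set_converges_to_def)
    then obtain V where V: "V \<in> \<C>" "x \<in> V"
      by blast
    have "finite (A \<inter> topspace T - V)"
      using finite_Diff_refinement_subbase[OF conv[OF 3(1)] ad 3(1)] V sub by blast
    then have "finite (\<Union>\<C> - \<Union>{V, topspace T - insert x B})"
      by (rule rev_finite_subset) (use V 3(2) cover' in auto)
    then show ?thesis
      using 3 V by (intro finite_subcover_if_almost_covers[of "{V, topspace T - insert x B}"]) auto
  qed
  then show "\<exists>\<C>'. finite \<C>' \<and> \<C>' \<subseteq> \<C> \<and> \<Union>\<C>' = \<Union>(refinement_subbase T M)"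
    by (simp add: cover)
qed

section \<open>Uniqueness of sequential limits\<close>

text \<open>If the range were finite, some value \<open>c\<close> would be taken infinitely often, and then no point
  other than \<open>c\<close> could be a limit, because the complement of \<open>{c}\<close> is open.\<close>

lemma infinite_range_if_two_limits:
  assumes closed: "\<And>c. openin T (topspace T - {c})"
    and lim: "limitin T s l sequentially" "limitin T s l' sequentially" "l \<noteq> l'"
  shows "infinite (range s)"
proof
  assume "finite (range s)"
  then obtain c where inf: "infinite {n. s n = c}"
    using pigeonhole_infinite[of "UNIV :: nat set" s] by auto
  have "m = c" if "limitin T s m sequentially" for m
  proof (rule ccontr)
    assume "m \<noteq> c"
    then have "eventually (\<lambda>n. s n \<in> topspace T - {c}) sequentially"
      using that closed[of c] by (auto simp: limitin_def)
    then have "finite {n. s n \<notin> topspace T - {c}}"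
      by (simp add: eventually_cofinite flip: cofinite_eq_sequentially)
    then have "finite {n. s n = c}"
      by (rule rev_finite_subset) auto
    with inf show False
      by simp
  qed
  with lim show False
    by blast
qed

text \<open>Maximality puts infinitely many terms of a sequence with two limits into one set \<open>A\<close> of the
  family. All \<open>B \<union> {x}\<close> with \<open>B \<subseteq> A\<close> were made closed, and not only \<open>A \<union> {x}\<close>, in order
  to exclude limits that belong to \<open>A\<close>.\<close>

lemma US_space_refinement:
  assumes max: "\<And>C y. set_converges_to T C y \<Longrightarrow> \<exists>(A, x) \<in> M. infinite (A \<inter> C)"
  shows "US_space (refinement T M)"
  unfolding US_space_def
proof (intro allI impI, rule ccontr)
  fix s :: "nat \<Rightarrow> 'a" and l l'
  assume lim: "limitin (refinement T M) s l sequentially"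
      "limitin (refinement T M) s l' sequentially"
    and "l \<noteq> l'"
  then have inf: "infinite (range s)"
    by (intro infinite_range_if_two_limits[of "refinement T M" s l l'])
      (simp_all add: openin_refinement_cofinite)
  have "limitin T s l sequentially"
    using lim(1) by (auto simp: limitin_def intro: openin_refinement)
  then have "set_converges_to T (range s) l"
    using inf by (rule set_converges_to_range)
  then obtain A x where Ax: "(A, x) \<in> M" "infinite (A \<inter> range s)"
    using max by blast
  have "m = x" if m: "limitin (refinement T M) s m sequentially" for m
  proof (rule ccontr)
    assume "m \<noteq> x"
    define B where "B = A \<inter> range s - {m}"
    have "m \<in> topspace T - insert x B"
      using m \<open>m \<noteq> x\<close> by (auto simp: B_def limitin_def)
    moreover have "openin (refinement T M) (topspace T - insert x B)"
      using Ax(1) by (rule openin_refinement_Diff_insert) (auto simp: B_def)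
    moreover have "set_converges_to (refinement T M) (range s) m"
      using m inf by (rule set_converges_to_range)
    ultimately have "finite (range s - (topspace T - insert x B))"
      by (auto simp: set_converges_to_def)
    then have "finite B"
      by (rule rev_finite_subset) (auto simp: B_def)
    then show False
      using Ax(2) by (simp add: B_def)
  qed
  with lim \<open>l \<noteq> l'\<close> show False
    by blast
qed

theorem corollary1:
  fixes X :: "'a set" and \<tau> :: "'a topology"
  assumes "topspace \<tau> = X" and "compact_space \<tau>"
  shows "\<exists>\<tau>' :: 'a topology. topspace \<tau>' = X \<and> compact_space \<tau>' \<and>
           {U. openin \<tau> U} \<subseteq> {U. openin \<tau>' U} \<and> US_space \<tau>'"
proof -
  obtain M where conv: "\<And>A x. (A, x) \<in> M \<Longrightarrow> set_converges_to \<tau> A x"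
    and ad: "almost_disjoint M"
    and max: "\<And>C y. set_converges_to \<tau> C y \<Longrightarrow> \<exists>(A, x) \<in> M. infinite (A \<inter> C)"
    by (rule maximal_almost_disjoint_family[of \<tau>]) blast
  have "compact_space (refinement \<tau> M)"
    using assms(2) ad conv by (rule compact_space_refinement)
  moreover have "US_space (refinement \<tau> M)"
    using max by (rule US_space_refinement)
  ultimately show ?thesis
    using assms(1) by (intro exI[of _ "refinement \<tau> M"]) (auto intro: openin_refinement)
qed

end
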